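(* Let $\lambda\ge0$ and let $u_{0,1},u_{0,2}$ be compactly supported Borel probability measures on $\mathbb{R}^d$, with supports $A_1,A_2$. Assume that there exist constants $c>0$, $\alpha\ge0$, $r_0>0$ such that for each $i\in\{1,2\}$, $$\inf_{x\in A_i}u_{0,i}\bigl(B(x,r)\bigr)\ge c\,r^\alpha\qquad\forall r\in(0,r_0].$$ Then for each $i\in\{1,2\}$, all $x\in\mathbb{R}^d$ and all $0<t\le r_0^2$, $$u_i(x,t)\le(4\pi t)^{-d/2}\exp\Bigl(-\frac{d_i(x)^2}{4t}\Bigr),$$ $$u_i(x,t)\ge c\,t^{\alpha/2}(4\pi t)^{-d/2}\exp\Bigl(-\frac{(d_i(x)+\sqrt t)^2}{4t}\Bigr).$$ Consequently, for all $x\in\mathbb{R}^d$ and $0<t\le r_0^2$, $$\bigl|\Phi_\lambda(x)-F_\lambda(x,t)\bigr|\le C_1(x)\sqrt t+C_2\,t(1+|\log t|),$$ where $C_1(x)=2|\lambda|\,d_1(x)+2|1-\lambda|\,d_2(x)$ and $$C_2=\max\bigl\{1+4|\log c|+2d\log(4\pi),\ 2\alpha+2d\bigr\}\,(|\lambda|+|1-\lambda|).$$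
   Context: Heat flows: for $i=1,2$ and $t>0$, $u_i(\cdot,t)=G_t*u_{0,i}$ with $G_t(z)=(4\pi t)^{-d/2}e^{-\|z\|^2/(4t)}$. $B(x,r)$ is the ball of center $x$ and radius $r$. $d_i(x)=\mathrm{dist}(x,A_i)$ with $A_i=\mathrm{supp}(u_{0,i})$, while $d$ (no subscript) is the space dimension. $\Phi_\lambda(x)=\lambda d_1(x)^2+(1-\lambda)d_2(x)^2$. Rescaled potential: $F_\lambda(x,t)=-4t\bigl(\lambda\log u_1(x,t)+(1-\lambda)\log u_2(x,t)\bigr)$. *)

theory Defs
  imports "HOL-Probability.Probability"
begin

definition supp :: "'a::topological_space measure \<Rightarrow> 'a set" where
  "supp \<mu> = {x. \<forall>U. open U \<longrightarrow> x \<in> U \<longrightarrow> emeasure \<mu> U > 0}"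

definition compactly_supported_borel_prob :: "'a::topological_space measure \<Rightarrow> bool" where
  "compactly_supported_borel_prob \<mu> \<longleftrightarrow>
     sets \<mu> = sets borel \<and> prob_space \<mu> \<and> compact (supp \<mu>)"

definition heat_kernel :: "real \<Rightarrow> 'a::euclidean_space \<Rightarrow> real" where
  "heat_kernel t z = (4 * pi * t) powr (- real DIM('a) / 2) * exp (- (norm z)\<^sup>2 / (4 * t))"

text \<open>The convolution \<open>G\<^sub>t * \<mu>\<close> of the heat kernel with a measure, as a function of the point.\<close>

definition heat_flow :: "'a::euclidean_space measure \<Rightarrow> 'a \<Rightarrow> real \<Rightarrow> real" where
  "heat_flow \<mu> x t = (\<integral>y. heat_kernel t (x - y) \<partial>\<mu>)"

definition dist_supp :: "'a::metric_space measure \<Rightarrow> 'a \<Rightarrow> real" where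
  "dist_supp \<mu> x = infdist x (supp \<mu>)"

definition Phi :: "real \<Rightarrow> 'a::metric_space measure \<Rightarrow> 'a measure \<Rightarrow> 'a \<Rightarrow> real" where
  "Phi lam \<mu> \<nu> x = lam * (dist_supp \<mu> x)\<^sup>2 + (1 - lam) * (dist_supp \<nu> x)\<^sup>2"

definition rescaled_potential ::
    "real \<Rightarrow> 'a::euclidean_space measure \<Rightarrow> 'a measure \<Rightarrow> 'a \<Rightarrow> real \<Rightarrow> real" where
  "rescaled_potential lam \<mu> \<nu> x t =
     - 4 * t * (lam * ln (heat_flow \<mu> x t) + (1 - lam) * ln (heat_flow \<nu> x t))"

end

theory Submission
  imports Defs
begin

text \<open>A measure is concentrated on its support, so the kernel at distance at least \<open>dist_supp\<close>
  bounds the heat flow from above, while the mass of a ball of radius \<open>sqrt t\<close> around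
  a nearest point of the support bounds it from below. Taking logarithms turns the two bounds into
  the comparison of the squared distance with the rescaled potential.\<close>

text \<open>Closedness is what makes the distance to the support attained, as the lower bound on the
  heat flow requires.\<close>

lemma closed_supp: "closed (supp \<mu>)"
proof -
  have "- supp \<mu> = \<Union>{U. open U \<and> emeasure \<mu> U = 0}"
    by (auto simp: supp_def not_gr_zero)
  then show ?thesis
    unfolding closed_def by (metis (no_types, lifting) mem_Collect_eq open_Union)
qed

text \<open>Each point off the support has a null open neighbourhood, but there may be uncountably
  many of these. Shrinking each one to a member of a countable basis leaves a countable family of
  null sets that still covers the complement.\<close>

lemma AE_in_supp:
  fixes \<mu> :: "'a::second_countable_topology measure"
  assumes "sets \<mu> = sets borel"
  shows "AE y in \<mu>. y \<in> supp \<mu>"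
proof -
  obtain B :: "'a set set" where B: "countable B" "topological_basis B"
    using ex_countable_basis by blast
  define N where "N = {b \<in> B. emeasure \<mu> b = 0}"
  have "countable N"
    unfolding N_def using B(1) by simp
  moreover have "b \<in> null_sets \<mu>" if "b \<in> N" for b
    using that topological_basis_open[OF B(2)] assms by (auto simp: N_def null_sets_def)
  ultimately have null: "\<Union>N \<in> null_sets \<mu>"
    using null_sets_UN'[of N "\<lambda>b. b" \<mu>] by simp
  have "{y \<in> space \<mu>. \<not> y \<in> supp \<mu>} \<subseteq> \<Union>N"
  proof
    fix y assume "y \<in> {y \<in> space \<mu>. \<not> y \<in> supp \<mu>}"
    then obtain U where U: "open U" "y \<in> U" "emeasure \<mu> U = 0"
      by (auto simp: supp_def not_gr_zero)
    obtain b where b: "b \<in> B" "y \<in> b" "b \<subseteq> U"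
      using topological_basisE[OF B(2) U(1,2)] by blast
    have "emeasure \<mu> b \<le> emeasure \<mu> U"
      using b(3) U(1) assms by (intro emeasure_mono) auto
    then show "y \<in> \<Union>N"
      using b U(3) by (auto simp: N_def)
  qed
  then show ?thesis
    using null by (rule AE_I'[rotated])
qed

text \<open>The bound squares \<open>a\<close>, so its sign matters; in
  \<open>heat_kernel_ge\<close> the corresponding \<open>b\<close> is nonnegative because it
  dominates a norm.\<close>

lemma heat_kernel_antimono:
  fixes z :: "'a::euclidean_space"
  assumes "t > 0" "0 \<le> a" "a \<le> norm z"
  shows "heat_kernel t z \<le> (4 * pi * t) powr (- real DIM('a) / 2) * exp (- a\<^sup>2 / (4 * t))"
  unfolding heat_kernel_def using assms
  by (intro mult_left_mono) (auto simp: divide_right_mono power_mono)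

lemma heat_kernel_ge:
  fixes z :: "'a::euclidean_space"
  assumes "t > 0" "norm z \<le> b"
  shows "(4 * pi * t) powr (- real DIM('a) / 2) * exp (- b\<^sup>2 / (4 * t)) \<le> heat_kernel t z"
  unfolding heat_kernel_def using assms
  by (intro mult_left_mono) (auto simp: divide_right_mono power_mono)

lemma heat_kernel_nonneg: "0 \<le> heat_kernel t z"
  by (simp add: heat_kernel_def)

lemma integrable_heat_kernel:
  fixes M :: "'a::euclidean_space measure"
  assumes "prob_space M" "sets M = sets borel" "t > 0"
  shows "integrable M (\<lambda>y. heat_kernel t (x - y))"
proof -
  interpret prob_space M by fact
  show ?thesis
  proof (rule integrable_const_bound)
    \<comment> \<open>The kernel is largest at the origin: this is the previous bound with
      \<open>a = 0\<close>.\<close>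
    show "AE y in M. norm (heat_kernel t (x - y)) \<le> (4 * pi * t) powr (- real DIM('a) / 2)"
      using heat_kernel_antimono[OF assms(3), of 0 "x - y" for y] by (simp add: heat_kernel_nonneg)
    have "continuous_on UNIV (\<lambda>y. heat_kernel t (x - y))"
      unfolding heat_kernel_def by (intro continuous_intros) (use assms in auto)
    then show "(\<lambda>y. heat_kernel t (x - y)) \<in> borel_measurable M"
      using borel_measurable_continuous_onI measurable_cong_sets[OF assms(2) refl] by blast
  qed
qed

lemma heat_flow_le:
  fixes M :: "'a::euclidean_space measure"
  assumes "prob_space M" "sets M = sets borel" "t > 0"
  shows "heat_flow M x t
    \<le> (4 * pi * t) powr (- real DIM('a) / 2) * exp (- (dist_supp M x)\<^sup>2 / (4 * t))" (is "_ \<le> ?K")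
proof -
  interpret prob_space M by fact
  have "AE y in M. heat_kernel t (x - y) \<le> ?K"
    using AE_in_supp[OF assms(2)]
  proof eventually_elim
    case (elim y)
    then have "dist_supp M x \<le> norm (x - y)"
      unfolding dist_supp_def by (metis dist_norm infdist_le)
    then show ?case
      using assms(3) by (intro heat_kernel_antimono) (auto simp: dist_supp_def infdist_nonneg)
  qed
  then show ?thesis
    unfolding heat_flow_def
    by (rule integral_le_const[OF integrable_heat_kernel[OF assms]])
qed

text \<open>The radius \<open>sqrt t\<close> is the length scale of the kernel: restricting the
  integral to such a ball enlarges the distance in the exponent by \<open>sqrt t\<close> only, which
  after multiplication by \<open>4 * t\<close> is an error of order \<open>sqrt t\<close>.\<close>

lemma heat_flow_ge:
  fixes M :: "'a::euclidean_space measure"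
  assumes "prob_space M" "sets M = sets borel" "t > 0"
  assumes mass: "\<And>p. p \<in> supp M \<Longrightarrow> m \<le> measure M (ball p (sqrt t))"
  shows "m * ((4 * pi * t) powr (- real DIM('a) / 2)
      * exp (- (dist_supp M x + sqrt t)\<^sup>2 / (4 * t))) \<le> heat_flow M x t" (is "m * ?K \<le> _")
proof -
  interpret prob_space M by fact
  \<comment> \<open>An empty support would make a false statement hold almost everywhere in a
    probability space. The case must be excluded because \<open>infdist\<close> to the empty set is
    0 by convention and no nearest point would exist.\<close>
  have "supp M \<noteq> {}"
    using AE_in_supp[OF assms(2)] AE_False by auto
  then obtain p where p: "p \<in> supp M" "dist_supp M x = dist x p"
    using infdist_attains_inf[OF closed_supp] unfolding dist_supp_def by metis
  have B: "ball p (sqrt t) \<in> events"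
    using assms(2) by simp
  have "m * ?K \<le> prob (ball p (sqrt t)) * ?K"
    using mass[OF p(1)] by (intro mult_right_mono) auto
  also have "\<dots> = (\<integral>y. indicator (ball p (sqrt t)) y * ?K \<partial>M)"
    using B by (simp add: emeasure_eq_measure)
  \<comment> \<open>Pointwise comparison: on the ball the triangle inequality through
    \<open>p\<close> applies, and off the ball the left side vanishes while the kernel is
    nonnegative.\<close>
  also have "\<dots> \<le> (\<integral>y. heat_kernel t (x - y) \<partial>M)"
  proof (rule integral_mono)
    show "integrable M (\<lambda>y. indicator (ball p (sqrt t)) y * ?K)"
      using B by (intro integrable_mult_left) (simp add: emeasure_eq_measure)
    show "integrable M (\<lambda>y. heat_kernel t (x - y))"
      by (rule integrable_heat_kernel[OF assms(1-3)])
    fix y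
    have "norm (x - y) \<le> dist_supp M x + sqrt t" if "y \<in> ball p (sqrt t)"
      using that dist_triangle[of x y p] p(2) by (simp add: dist_norm)
    then show "indicator (ball p (sqrt t)) y * ?K \<le> heat_kernel t (x - y)"
      using heat_kernel_ge[OF assms(3)] by (auto simp: indicator_def heat_kernel_nonneg)
  qed
  finally show ?thesis
    by (simp add: heat_flow_def)
qed

text \<open>The real-variable core for one measure, with \<open>u\<close> the value of the heat
  flow, \<open>\<delta>\<close> the distance and \<open>D\<close> the dimension. Multiplying the
  logarithms by \<open>4 * t\<close> turns the Gaussian exponents into squares, the prefactor into
  \<open>- 2 * D * t * ln (4 * pi * t)\<close> and the mass factor into
  \<open>4 * t * ln c + 2 * \<alpha> * t * ln t\<close>.\<close>

lemma abs_sq_minus_log_le: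
  fixes u D c t \<alpha> \<delta> :: real
  assumes "t > 0" "c > 0" "\<alpha> \<ge> 0" "D \<ge> 0" "\<delta> \<ge> 0"
    and le: "u \<le> (4 * pi * t) powr (- D / 2) * exp (- \<delta>\<^sup>2 / (4 * t))"
    and ge: "c * t powr (\<alpha> / 2) * (4 * pi * t) powr (- D / 2) * exp (- (\<delta> + sqrt t)\<^sup>2 / (4 * t)) \<le> u"
  shows "\<bar>\<delta>\<^sup>2 + 4 * t * ln u\<bar> \<le> 2 * \<delta> * sqrt t
    + max (1 + 4 * \<bar>ln c\<bar> + 2 * D * ln (4 * pi)) (2 * \<alpha> + 2 * D) * (t * (1 + \<bar>ln t\<bar>))"
    (is "_ \<le> _ + ?M * _")
proof -
  define l where "l = ln (4 * pi)"
  define s where "s = ln t"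
  have l: "l \<ge> 0"
    unfolding l_def using pi_gt3 by (intro ln_ge_zero) simp
  have pos: "0 < c * t powr (\<alpha> / 2) * (4 * pi * t) powr (- D / 2) * exp (- (\<delta> + sqrt t)\<^sup>2 / (4 * t))"
    using assms by simp
  then have "u > 0"
    using ge by linarith
  then have "ln u \<le> ln ((4 * pi * t) powr (- D / 2) * exp (- \<delta>\<^sup>2 / (4 * t)))"
    using le by simp
  also have "\<dots> = - D / 2 * (l + s) - \<delta>\<^sup>2 / (4 * t)"
    using assms(1) by (simp add: ln_mult ln_powr l_def s_def)
  finally have "4 * t * ln u \<le> 4 * t * (- D / 2 * (l + s) - \<delta>\<^sup>2 / (4 * t))"
    using assms(1) by (intro mult_left_mono) auto
  also have "\<dots> = - 2 * D * t * (l + s) - \<delta>\<^sup>2"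
    using assms(1) by (simp add: field_simps)
  finally have upper: "\<delta>\<^sup>2 + 4 * t * ln u \<le> - 2 * D * t * (l + s)"
    by simp
  have "ln (c * t powr (\<alpha> / 2) * (4 * pi * t) powr (- D / 2) * exp (- (\<delta> + sqrt t)\<^sup>2 / (4 * t))) \<le> ln u"
    using ge pos \<open>u > 0\<close> by simp
  then have "ln c + \<alpha> / 2 * s - D / 2 * (l + s) - (\<delta> + sqrt t)\<^sup>2 / (4 * t) \<le> ln u"
    using assms(1,2) by (simp add: ln_mult ln_powr l_def s_def)
  then have "4 * t * (ln c + \<alpha> / 2 * s - D / 2 * (l + s) - (\<delta> + sqrt t)\<^sup>2 / (4 * t)) \<le> 4 * t * ln u"
    using assms(1) by (intro mult_left_mono) auto
  moreover have "4 * t * (ln c + \<alpha> / 2 * s - D / 2 * (l + s) - (\<delta> + sqrt t)\<^sup>2 / (4 * t))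
      = 4 * t * ln c + 2 * \<alpha> * t * s - 2 * D * t * (l + s) - (\<delta> + sqrt t)\<^sup>2"
    using assms(1) by (simp add: field_simps)
  moreover have "(\<delta> + sqrt t)\<^sup>2 = \<delta>\<^sup>2 + 2 * \<delta> * sqrt t + t"
    using assms(1) by (simp add: power2_sum)
  ultimately have lower: "4 * t * ln c + 2 * \<alpha> * t * s - 2 * D * t * (l + s) - 2 * \<delta> * sqrt t - t
      \<le> \<delta>\<^sup>2 + 4 * t * ln u"
    by linarith
  \<comment> \<open>The signs of \<open>ln c\<close>, \<open>s\<close> and \<open>l + s\<close> are
    unknown, so each term is replaced by its absolute value; the final estimate is then linear in
    these products.\<close>
  have c: "4 * t * \<bar>ln c\<bar> \<ge> - (4 * t * ln c)" "4 * t * \<bar>ln c\<bar> \<ge> 0"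
    using assms(1) abs_ge_minus_self[of "4 * t * ln c"] by (auto simp: abs_mult)
  have \<alpha>: "2 * \<alpha> * t * \<bar>s\<bar> \<ge> - (2 * \<alpha> * t * s)" "2 * \<alpha> * t * \<bar>s\<bar> \<ge> 0"
    using assms(1,3) abs_ge_minus_self[of "2 * \<alpha> * t * s"] by (auto simp: abs_mult)
  have D: "2 * D * t * l + 2 * D * t * \<bar>s\<bar> \<ge> \<bar>2 * D * t * (l + s)\<bar>"
  proof -
    have "\<bar>2 * D * t * (l + s)\<bar> = 2 * D * t * \<bar>l + s\<bar>"
      using assms(1,4) by (simp add: abs_mult)
    also have "\<dots> \<le> 2 * D * t * (l + \<bar>s\<bar>)"
      using assms(1,4) l by (intro mult_left_mono) auto
    finally show ?thesis
      by (simp add: algebra_simps)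
  qed
  have \<delta>: "2 * \<delta> * sqrt t \<ge> 0"
    using assms by simp
  have "\<bar>\<delta>\<^sup>2 + 4 * t * ln u\<bar> \<le> 2 * \<delta> * sqrt t
      + (t + 4 * t * \<bar>ln c\<bar> + 2 * D * t * l + (2 * \<alpha> * t * \<bar>s\<bar> + 2 * D * t * \<bar>s\<bar>))"
    using upper lower c \<alpha> D \<delta> assms(1) by linarith
  \<comment> \<open>Sorting by whether \<open>\<bar>s\<bar>\<close> occurs yields the two entries of
    the maximum: the first is the coefficient of \<open>t\<close>, the second that of
    \<open>t * \<bar>s\<bar>\<close>.\<close>
  also have "\<dots> = 2 * \<delta> * sqrt t
      + ((1 + 4 * \<bar>ln c\<bar> + 2 * D * l) * t + (2 * \<alpha> + 2 * D) * (t * \<bar>s\<bar>))"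
    by (simp add: algebra_simps)
  also have "\<dots> \<le> 2 * \<delta> * sqrt t + (?M * t + ?M * (t * \<bar>s\<bar>))"
    using assms(1) by (intro add_left_mono add_mono mult_right_mono) (auto simp: l_def)
  finally show ?thesis
    by (simp add: algebra_simps s_def)
qed

theorem lemma6p2:
  fixes u0 :: "nat \<Rightarrow> 'a::euclidean_space measure"
    and lam c \<alpha> r0 :: real
  assumes "lam \<ge> 0"
    and "\<forall>i\<in>{1, 2}. compactly_supported_borel_prob (u0 i)"
    and "c > 0" and "\<alpha> \<ge> 0" and "r0 > 0"
    and "\<forall>i\<in>{1, 2}. \<forall>r\<in>{0<..r0}. (INF x\<in>supp (u0 i). measure (u0 i) (ball x r)) \<ge> c * r powr \<alpha>"
  shows "(\<forall>i\<in>{1, 2}. \<forall>x. \<forall>t\<in>{0<..r0\<^sup>2}.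
            heat_flow (u0 i) x t
              \<le> (4 * pi * t) powr (- real DIM('a) / 2) * exp (- (dist_supp (u0 i) x)\<^sup>2 / (4 * t))
          \<and> heat_flow (u0 i) x t
              \<ge> c * t powr (\<alpha> / 2) * (4 * pi * t) powr (- real DIM('a) / 2)
                  * exp (- (dist_supp (u0 i) x + sqrt t)\<^sup>2 / (4 * t)))
       \<and> (\<forall>x. \<forall>t\<in>{0<..r0\<^sup>2}.
            \<bar>Phi lam (u0 1) (u0 2) x - rescaled_potential lam (u0 1) (u0 2) x t\<bar>
              \<le> (2 * \<bar>lam\<bar> * dist_supp (u0 1) x + 2 * \<bar>1 - lam\<bar> * dist_supp (u0 2) x) * sqrt t
                + max (1 + 4 * \<bar>ln c\<bar> + 2 * real DIM('a) * ln (4 * pi)) (2 * \<alpha> + 2 * real DIM('a))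
                    * (\<bar>lam\<bar> + \<bar>1 - lam\<bar>) * (t * (1 + \<bar>ln t\<bar>)))"
proof -
  define K where "K i x t = (4 * pi * t) powr (- real DIM('a) / 2)
    * exp (- (dist_supp (u0 i) x)\<^sup>2 / (4 * t))" for i t and x :: 'a
  define L where "L i x t = c * t powr (\<alpha> / 2) * (4 * pi * t) powr (- real DIM('a) / 2)
    * exp (- (dist_supp (u0 i) x + sqrt t)\<^sup>2 / (4 * t))" for i t and x :: 'a
  define M where "M = max (1 + 4 * \<bar>ln c\<bar> + 2 * real DIM('a) * ln (4 * pi)) (2 * \<alpha> + 2 * real DIM('a))"
  have bounds: "heat_flow (u0 i) x t \<le> K i x t" "L i x t \<le> heat_flow (u0 i) x t"
    if i: "i \<in> {1, 2}" and t: "t \<in> {0<..r0\<^sup>2}" for i x t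
  proof -
    have sets: "sets (u0 i) = sets borel" and prob: "prob_space (u0 i)"
      using assms(2) i by (auto simp: compactly_supported_borel_prob_def)
    interpret prob_space "u0 i" by fact
    have "sqrt t \<le> r0"
      using t assms(5) by (simp add: real_le_lsqrt)
    \<comment> \<open>The mass hypothesis at radius \<open>r = sqrt t\<close>; this is where
      \<open>t \<le> r0\<^sup>2\<close> enters.\<close>
    then have inf: "c * sqrt t powr \<alpha> \<le> (INF x\<in>supp (u0 i). prob (ball x (sqrt t)))"
      using assms(6) i t by auto
    have "sqrt t powr \<alpha> = t powr (\<alpha> / 2)"
      using t by (simp add: powr_half_sqrt[symmetric] powr_powr)
    \<comment> \<open>A real infimum lies below its members only for a family bounded below; here 0
      is a lower bound.\<close>
    moreover have "(INF x\<in>supp (u0 i). prob (ball x (sqrt t))) \<le> prob (ball p (sqrt t))"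
      if "p \<in> supp (u0 i)" for p
      using that by (intro cINF_lower bdd_belowI2[where m = 0]) auto
    ultimately have "c * t powr (\<alpha> / 2) \<le> prob (ball p (sqrt t))" if "p \<in> supp (u0 i)" for p
      using that inf by fastforce
    then show "L i x t \<le> heat_flow (u0 i) x t"
      using heat_flow_ge[OF prob sets, of t "c * t powr (\<alpha> / 2)" x] t by (simp add: L_def mult.assoc)
    show "heat_flow (u0 i) x t \<le> K i x t"
      using heat_flow_le[OF prob sets] t by (simp add: K_def)
  qed
  have "\<bar>Phi lam (u0 1) (u0 2) x - rescaled_potential lam (u0 1) (u0 2) x t\<bar>
      \<le> (2 * \<bar>lam\<bar> * dist_supp (u0 1) x + 2 * \<bar>1 - lam\<bar> * dist_supp (u0 2) x) * sqrt t
        + M * (\<bar>lam\<bar> + \<bar>1 - lam\<bar>) * (t * (1 + \<bar>ln t\<bar>))"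
    if t: "t \<in> {0<..r0\<^sup>2}" for x t
  proof -
    \<comment> \<open>The error of a single measure. The difference to be estimated is the
      combination of \<open>E 1\<close> and \<open>E 2\<close> with weights \<open>lam\<close> and
      \<open>1 - lam\<close>; the second weight is negative when \<open>lam > 1\<close>, hence the
      absolute values in the constants.\<close>
    define E where "E i = (dist_supp (u0 i) x)\<^sup>2 + 4 * t * ln (heat_flow (u0 i) x t)" for i
    have E: "\<bar>E i\<bar> \<le> 2 * dist_supp (u0 i) x * sqrt t + M * (t * (1 + \<bar>ln t\<bar>))"
      if "i \<in> {1, 2}" for i
      unfolding E_def M_def
      using t assms(3,4) bounds[OF that t, of x, unfolded K_def L_def]
      by (intro abs_sq_minus_log_le) (auto simp: dist_supp_def infdist_nonneg)
    have "Phi lam (u0 1) (u0 2) x - rescaled_potential lam (u0 1) (u0 2) x t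
        = lam * E 1 + (1 - lam) * E 2"
      by (simp add: Phi_def rescaled_potential_def E_def algebra_simps)
    also have "\<bar>\<dots>\<bar> \<le> \<bar>lam\<bar> * \<bar>E 1\<bar> + \<bar>1 - lam\<bar> * \<bar>E 2\<bar>"
      by (metis abs_mult abs_triangle_ineq)
    also have "\<dots> \<le> \<bar>lam\<bar> * (2 * dist_supp (u0 1) x * sqrt t + M * (t * (1 + \<bar>ln t\<bar>)))
        + \<bar>1 - lam\<bar> * (2 * dist_supp (u0 2) x * sqrt t + M * (t * (1 + \<bar>ln t\<bar>)))"
      using E by (intro add_mono mult_left_mono) auto
    finally show ?thesis
      by (simp add: algebra_simps)
  qed
  then show ?thesis
    using bounds unfolding K_def L_def M_def by blast
qed

end
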